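(* Fix $q>1$ and $r\in(0,1]$. Suppose that $\mu_1$ and $\mu_2$ are two probability measures on $\mathbb{R}^n$ such that for each $\mu\in\{\mu_1,\mu_2\}$ the inequality $$\|f_r\|_{q,\mu}\le\|f\|_{1,\mu}$$ holds for every continuous log-subharmonic function $f$ on $\mathbb{R}^n$, where $f_r(x)=f(rx)$. If at least one of $\mu_1$ and $\mu_2$ is compactly supported, then the convolution $\mu_1*\mu_2$ also satisfies $\|f_r\|_{q,\mu_1*\mu_2}\le\|f\|_{1,\mu_1*\mu_2}$ for every continuous log-subharmonic function $f$ on $\mathbb{R}^n$.
   Context: A function $u:\mathbb{R}^n\to[-\infty,\infty)$ that is upper semicontinuous, locally integrable and not identically $-\infty$ is called subharmonic if for all $x,y\in\mathbb{R}^n$, $u(x)\le\int_{O(n)}u(x+\alpha y)\,d\alpha$, where $d\alpha$ is normalized Haar measure on the orthogonal group $O(n)$. A function $g:\mathbb{R}^n\to[0,\infty)$ is log-subharmonic if $\log g$ is subharmonic (with $\log 0=-\infty$). For a probability measure $m$ and $0<p<\infty$, $\|f\|_{p,m}=(\int|f|^p\,dm)^{1/p}\in[0,\infty]$. *)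

theory Defs
  imports "HOL-Probability.Probability"
begin

text \<open>Normalized Haar measure on the orthogonal group, as a measure whose underlying space is
  the set of orthogonal matrices with its Borel sigma-algebra. Since the group is compact and
  metrizable, regularity is automatic.\<close>

definition normalized_haar_orthogonal :: "(real ^ 'n ^ 'n) measure \<Rightarrow> bool" where
  "normalized_haar_orthogonal H \<longleftrightarrow>
     prob_space H \<and>
     space H = {A. orthogonal_matrix A} \<and>
     sets H = sets (restrict_space borel {A. orthogonal_matrix A}) \<and>
     (\<forall>B E. orthogonal_matrix B \<longrightarrow> E \<in> sets H \<longrightarrow>
        emeasure H ((\<lambda>A. B ** A) ` E) = emeasure H E)"

text \<open>\<^const>\<open>e2ennreal\<close> sends negative values to 0, so the two terms are the
  integrals of the positive and the negative part. For upper semicontinuous functions with values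
  in \<open>[-\<infinity>, \<infinity>)\<close> on a compact space the first
  term is finite, so that no difference of infinities occurs.\<close>

definition ereal_integral :: "'a measure \<Rightarrow> ('a \<Rightarrow> ereal) \<Rightarrow> ereal" where
  "ereal_integral M f =
     enn2ereal (\<integral>\<^sup>+ x. e2ennreal (f x) \<partial>M) - enn2ereal (\<integral>\<^sup>+ x. e2ennreal (- f x) \<partial>M)"

definition upper_semicontinuous :: "('a::topological_space \<Rightarrow> ereal) \<Rightarrow> bool" where
  "upper_semicontinuous u \<longleftrightarrow> (\<forall>c. open {x. u x < c})"

definition locally_integrable :: "(real ^ 'n \<Rightarrow> ereal) \<Rightarrow> bool" where
  "locally_integrable u \<longleftrightarrow>
     u \<in> borel_measurable lebesgue \<and>
     (\<forall>K. compact K \<longrightarrow> (\<integral>\<^sup>+ x\<in>K. e2ennreal \<bar>u x\<bar> \<partial>lebesgue) < \<infinity>)"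

text \<open>By uniqueness of normalized Haar measure, \<open>H\<close> below is that measure.\<close>

definition subharmonic :: "(real ^ 'n \<Rightarrow> ereal) \<Rightarrow> bool" where
  "subharmonic u \<longleftrightarrow>
     (\<forall>x. u x < \<infinity>) \<and>
     upper_semicontinuous u \<and>
     locally_integrable u \<and>
     (\<exists>x. u x \<noteq> -\<infinity>) \<and>
     (\<exists>H. normalized_haar_orthogonal H \<and>
        (\<forall>x y. u x \<le> ereal_integral H (\<lambda>A. u (x + A *v y))))"

definition ext_log :: "real \<Rightarrow> ereal" where
  "ext_log t = (if t = 0 then -\<infinity> else ereal (ln t))"

definition log_subharmonic :: "(real ^ 'n \<Rightarrow> real) \<Rightarrow> bool" where
  "log_subharmonic g \<longleftrightarrow> (\<forall>x. 0 \<le> g x) \<and> subharmonic (\<lambda>x. ext_log (g x))"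

definition ennreal_powr :: "ennreal \<Rightarrow> real \<Rightarrow> ennreal" where
  "ennreal_powr a s = (if a = \<infinity> then \<infinity> else ennreal (enn2real a powr s))"

definition Lp_norm :: "real \<Rightarrow> 'a measure \<Rightarrow> ('a \<Rightarrow> real) \<Rightarrow> ennreal" where
  "Lp_norm p M f = ennreal_powr (\<integral>\<^sup>+ x. ennreal (\<bar>f x\<bar> powr p) \<partial>M) (1 / p)"

definition topological_support :: "'a::topological_space measure \<Rightarrow> 'a set" where
  "topological_support M = {x. \<forall>U. open U \<longrightarrow> x \<in> U \<longrightarrow> 0 < emeasure M U}"

definition compactly_supported :: "'a::topological_space measure \<Rightarrow> bool" where
  "compactly_supported M \<longleftrightarrow> compact (topological_support M)"

end

theory Submission
  imports Defs
begin

text \<open>Convolution is commutative, so let \<open>\<mu>2\<close> be the compactly supported measure. The inequality for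
  \<open>\<mu>2\<close>, applied to the translates \<open>y \<mapsto> f (r x + y)\<close>, bounds the inner integral by \<open>g (r x)\<close>, where
  \<open>g x = \<integral> f (x + y) d\<mu>2 y\<close>; the inequality for \<open>\<mu>1\<close>, applied to \<open>g\<close>, then finishes the proof.
  Compactness of the support makes \<open>g\<close> finite and continuous. For the sub-mean value property of
  \<open>log g\<close>, bound \<open>f\<close> by the geometric mean of its rotated translates and use that
  the geometric mean is superadditive:
  \<open>\<integral> exp (\<integral> log F A z dA) dz \<le> exp (\<integral> log (\<integral> F A z dz) dA)\<close>.\<close>

section \<open>Null sets off the support, Jensen's inequality and local bounds\<close>

text \<open>The complement is the union of all open null sets. By Lindelof a countable subfamily has
  the same union, so countable subadditivity applies.\<close>

lemma emeasure_compl_topological_support: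
  fixes M :: "'a::second_countable_topology measure"
  assumes "sets M = sets borel"
  shows "emeasure M (- topological_support M) = 0"
proof -
  define \<F> where "\<F> = {U. open U \<and> emeasure M U = 0}"
  obtain \<G> where \<G>: "\<G> \<subseteq> \<F>" "countable \<G>" "\<Union>\<G> = \<Union>\<F>"
    using Lindelof[of \<F>] by (auto simp: \<F>_def)
  have "\<Union>\<G> \<in> null_sets M"
    using \<G>(1,2) assms by (intro null_sets_UN'[where N="\<lambda>U. U", simplified]) (auto simp: \<F>_def null_sets_def)
  moreover have "- topological_support M = \<Union>\<G>"
    unfolding \<G>(3) by (auto simp: topological_support_def \<F>_def zero_less_iff_neq_zero)
  ultimately show ?thesis by auto
qed

lemma (in prob_space) exp_expectation_le:
  fixes X :: "'a \<Rightarrow> real"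
  assumes "integrable M X" "integrable M (\<lambda>x. exp (X x))"
  shows "exp (expectation X) \<le> expectation (\<lambda>x. exp (X x))"
  by (rule jensens_inequality[where I=UNIV]) (use assms exp_convex in auto)

lemma continuous_bounded_on_cball:
  fixes f :: "'a::euclidean_space \<Rightarrow> real"
  assumes "continuous_on UNIV f"
  obtains B where "\<And>x. norm x \<le> R \<Longrightarrow> f x \<le> B"
proof -
  have "bounded (f ` cball 0 R)"
    by (intro compact_imp_bounded compact_continuous_image continuous_on_subset[OF assms]) auto
  then obtain B where "\<forall>x\<in>cball 0 R. norm (f x) \<le> B"
    by (auto simp: bounded_iff)
  then show ?thesis
    by (intro that[of B]) (auto simp: abs_le_iff)
qed

section \<open>The extended logarithm and its integrals\<close>

lemma measurable_ext_log[measurable]: "ext_log \<in> borel_measurable borel"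
  unfolding ext_log_def[abs_def] by measurable

lemma ext_log_less_iff: "0 \<le> t \<Longrightarrow> ext_log t < ereal c \<longleftrightarrow> t < exp c"
  unfolding ext_log_def by (auto simp: less_le) (metis exp_less_cancel_iff exp_ln less_le)+

lemma e2ennreal_ext_log: "0 \<le> t \<Longrightarrow> e2ennreal (ext_log t) = ennreal (ln (max t 1))"
  by (auto simp: ext_log_def e2ennreal_neg e2ennreal_ereal max_def ennreal_neg)

lemma e2ennreal_abs: "e2ennreal \<bar>x\<bar> = e2ennreal x + e2ennreal (- x)"
  by (cases x) (auto simp: e2ennreal_ereal ennreal_neg abs_if e2ennreal_neg)

lemma e2ennreal_uminus_ext_log_le:
  assumes "0 \<le> t" "0 \<le> s" "exp (- s) \<le> t"
  shows "e2ennreal (- ext_log t) \<le> ennreal s"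
proof -
  have "0 < t" using assms(3) by (smt (verit) exp_gt_zero)
  moreover then have "- ln t \<le> s" using assms(3) by (metis exp_le_cancel_iff exp_ln minus_le_iff)
  ultimately show ?thesis by (auto simp: ext_log_def e2ennreal_ereal ennreal_leI)
qed

text \<open>The upper bound \<open>B\<close> makes the positive part \<open>P\<close> finite, and
  the real lower bound \<open>c\<close> then excludes an infinite negative part \<open>N\<close>.
  Hence the logarithm is finite almost everywhere, and Bochner integrals and Jensen's inequality
  become available.\<close>

lemma (in prob_space) ereal_integral_ext_log_geD:
  assumes [measurable]: "F \<in> borel_measurable M"
    and F: "\<And>x. x \<in> space M \<Longrightarrow> 0 \<le> F x" "\<And>x. x \<in> space M \<Longrightarrow> F x \<le> B"
    and le: "ereal c \<le> ereal_integral M (\<lambda>x. ext_log (F x))"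
  shows "AE x in M. 0 < F x" "integrable M (\<lambda>x. ln (F x))" "c \<le> expectation (\<lambda>x. ln (F x))"
proof -
  define P where "P = (\<integral>\<^sup>+x. e2ennreal (ext_log (F x)) \<partial>M)"
  define N where "N = (\<integral>\<^sup>+x. e2ennreal (- ext_log (F x)) \<partial>M)"
  have "P \<le> (\<integral>\<^sup>+x. ennreal (ln (max B 1)) \<partial>M)"
    unfolding P_def by (intro nn_integral_mono) (use F in \<open>auto simp: e2ennreal_ext_log intro!: ennreal_leI max.coboundedI1\<close>)
  then have P: "P < \<infinity>"
    by (simp add: emeasure_space_1) (metis ennreal_less_top order.strict_trans1)
  have le': "ereal c \<le> enn2ereal P - enn2ereal N"
    using le by (simp add: ereal_integral_def P_def N_def)
  have N: "N < \<infinity>"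
    using le' P by (cases P; cases N) (auto simp: top_ennreal.rep_eq)
  have "AE x in M. e2ennreal (- ext_log (F x)) \<noteq> \<infinity>"
    using N unfolding N_def by (intro nn_integral_PInf_AE) auto
  with AE_space show pos: "AE x in M. 0 < F x"
    by eventually_elim (use F in \<open>force simp: ext_log_def less_le split: if_splits\<close>)
  have PN: "P = (\<integral>\<^sup>+x. ennreal (ln (F x)) \<partial>M)" "N = (\<integral>\<^sup>+x. ennreal (- ln (F x)) \<partial>M)"
    unfolding P_def N_def
    by (intro nn_integral_cong_AE; use pos in eventually_elim; force simp: ext_log_def e2ennreal_ereal)+
  show "integrable M (\<lambda>x. ln (F x))"
    using P N by (intro real_integrable_def[THEN iffD2]) (auto simp: PN)
  then show "c \<le> expectation (\<lambda>x. ln (F x))"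
    using le' P N unfolding PN
    by (subst real_lebesgue_integral_def)
      (auto simp: PN[symmetric] less_top elim!: less_top_ennreal[THEN iffD1, elim_format])
qed

text \<open>For \<open>t > 0\<close> the truncation at \<open>1 / Suc n\<close> is eventually
  inactive. For \<open>t = 0\<close> the terms are \<open>ln (Suc n)\<close>, which are unbounded
  and match the value \<infinity> on the left.\<close>

lemma e2ennreal_uminus_ext_log_le_SUP:
  assumes "0 \<le> t"
  shows "e2ennreal (- ext_log t) \<le> (SUP n. ennreal (- ln (max t (1 / real (Suc n)))))"
proof (cases "t = 0")
  case True
  have "\<exists>n. of_nat k \<le> ennreal (ln (real (Suc n)))" for k
  proof -
    obtain n where "exp (real k) \<le> real n" using real_arch_simple by blast
    then have "real k \<le> ln (real (Suc n))"
      by (subst ln_ge_iff) auto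
    then show ?thesis by (intro exI[of _ n]) (simp flip: ennreal_of_nat_eq_real_of_nat add: ennreal_leI)
  qed
  then have *: "(SUP n. ennreal (ln (real (Suc n)))) = \<infinity>"
    unfolding infinity_ennreal_def by (intro ennreal_SUP_eq_top) auto
  show ?thesis using True by (simp add: ln_div * del: of_nat_Suc)
next
  case False
  with assms obtain n where "1 / real (Suc n) < t"
    using nat_approx_posE[of t] by auto
  with False have "e2ennreal (- ext_log t) = ennreal (- ln (max t (1 / real (Suc n))))"
    by (simp add: ext_log_def e2ennreal_ereal max_def)
  then show ?thesis by (auto intro: SUP_upper2)
qed

text \<open>Truncating \<open>G\<close> at \<open>\<epsilon> \<le> 1\<close> leaves the positive part of \<open>log G\<close> unchanged, so only the
  negative parts have to pass to the limit \<open>\<epsilon> \<rightarrow> 0\<close>, and these increase.\<close>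

lemma (in prob_space) ereal_integral_ext_log_geI:
  assumes [measurable]: "G \<in> borel_measurable M"
    and G: "\<And>x. x \<in> space M \<Longrightarrow> 0 \<le> G x" "\<And>x. x \<in> space M \<Longrightarrow> G x \<le> B"
    and le: "\<And>\<epsilon>. 0 < \<epsilon> \<Longrightarrow> \<epsilon> \<le> 1 \<Longrightarrow> c \<le> expectation (\<lambda>x. ln (max (G x) \<epsilon>))"
  shows "ereal c \<le> ereal_integral M (\<lambda>x. ext_log (G x))"
proof -
  define P where "P = expectation (\<lambda>x. ln (max (G x) 1))"
  have int: "integrable M (\<lambda>x. ln (max (G x) \<epsilon>))" if "0 < \<epsilon>" for \<epsilon>
    by (intro integrable_const_bound[where B="\<bar>ln \<epsilon>\<bar> + \<bar>ln (max B \<epsilon>)\<bar>"] AE_I2)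
      (use that G in \<open>auto simp: max_def intro!: abs_leI\<close>, (smt (verit) ln_le_cancel_iff)+)
  have N: "(\<integral>\<^sup>+x. ennreal (- ln (max (G x) \<epsilon>)) \<partial>M) \<le> ennreal (P - c)" if "0 < \<epsilon>" "\<epsilon> \<le> 1" for \<epsilon>
  proof -
    \<comment> \<open>Since \<open>\<epsilon> \<le> 1\<close>, the positive part of
      \<open>ln (max (G x) \<epsilon>)\<close> is \<open>ln (max (G x) 1)\<close> for every
      \<open>\<epsilon>\<close>. The negative part is thus a difference whose integral is at most
      \<open>P - c\<close>, uniformly in \<open>\<epsilon>\<close>.\<close>
    have *: "max 0 (- ln (max (G x) \<epsilon>)) = ln (max (G x) 1) - ln (max (G x) \<epsilon>)" for x
      using that by (auto simp: max_def)
    have "(\<integral>\<^sup>+x. ennreal (- ln (max (G x) \<epsilon>)) \<partial>M) = (\<integral>\<^sup>+x. ennreal (ln (max (G x) 1) - ln (max (G x) \<epsilon>)) \<partial>M)"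
      by (intro nn_integral_cong) (metis * ennreal_max_0)
    also have "\<dots> = ennreal (expectation (\<lambda>x. ln (max (G x) 1) - ln (max (G x) \<epsilon>)))"
      using that by (intro nn_integral_eq_integral Bochner_Integration.integrable_diff int AE_I2) (auto simp flip: *)
    also have "\<dots> = ennreal (P - expectation (\<lambda>x. ln (max (G x) \<epsilon>)))"
      using that by (subst Bochner_Integration.integral_diff) (auto simp: P_def int)
    also have "\<dots> \<le> ennreal (P - c)"
      using le[OF that] by (intro ennreal_leI) auto
    finally show ?thesis .
  qed
  have "(\<integral>\<^sup>+x. e2ennreal (- ext_log (G x)) \<partial>M)
      \<le> (\<integral>\<^sup>+x. (SUP n. ennreal (- ln (max (G x) (1 / real (Suc n))))) \<partial>M)"
    by (intro nn_integral_mono e2ennreal_uminus_ext_log_le_SUP G)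
  also have "\<dots> = (SUP n. \<integral>\<^sup>+x. ennreal (- ln (max (G x) (1 / real (Suc n)))) \<partial>M)"
  proof (intro nn_integral_monotone_convergence_SUP incseq_SucI le_funI ennreal_leI)
    fix n x
    have "1 / real (Suc (Suc n)) \<le> 1 / real (Suc n)" by (intro divide_left_mono) auto
    moreover have "0 < 1 / real (Suc (Suc n))" by simp
    ultimately show "- ln (max (G x) (1 / real (Suc n))) \<le> - ln (max (G x) (1 / real (Suc (Suc n))))"
      by (subst neg_le_iff_le, subst ln_le_cancel_iff) (auto simp: less_max_iff_disj)
  qed measurable
  also have "\<dots> \<le> ennreal (P - c)"
    by (intro SUP_least N) auto
  finally have "(\<integral>\<^sup>+x. e2ennreal (- ext_log (G x)) \<partial>M) \<le> ennreal (P - c)" .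
  then have "ereal_integral M (\<lambda>x. ext_log (G x)) \<ge> enn2ereal (\<integral>\<^sup>+x. e2ennreal (ext_log (G x)) \<partial>M) - enn2ereal (ennreal (P - c))"
    unfolding ereal_integral_def by (intro ereal_minus_mono) (auto simp: less_eq_ennreal.rep_eq)
  also have "(\<integral>\<^sup>+x. e2ennreal (ext_log (G x)) \<partial>M) = (\<integral>\<^sup>+x. ennreal (ln (max (G x) 1)) \<partial>M)"
    using G by (intro nn_integral_cong) (auto simp: e2ennreal_ext_log)
  also have "\<dots> = ennreal P"
    unfolding P_def by (intro nn_integral_eq_integral int AE_I2) auto
  finally have "enn2ereal (ennreal P) - enn2ereal (ennreal (P - c)) \<le> ereal_integral M (\<lambda>x. ext_log (G x))" .
  \<comment> \<open>This makes \<open>P - c\<close> nonnegative, so \<open>ennreal (P - c)\<close>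
    is not cut off at 0 and the subtraction returns exactly \<open>c\<close>.\<close>
  moreover have "c \<le> P" using le[of 1] by (simp add: P_def)
  moreover have "0 \<le> P" unfolding P_def by (intro integral_nonneg_AE AE_I2) auto
  ultimately show ?thesis by (simp add: enn2ereal_ennreal)
qed

section \<open>Averages of a function over its translates\<close>

text \<open>The convolution of \<open>f\<close> with the reflection of \<open>M\<close>. It is
  real-valued because \<open>M\<close> will be concentrated on a ball and \<open>f\<close>
  continuous, so the default value 0 of the Bochner integral never intervenes.\<close>

definition translate_mean :: "'a::euclidean_space measure \<Rightarrow> ('a \<Rightarrow> real) \<Rightarrow> 'a \<Rightarrow> real" where
  "translate_mean M f x = (\<integral>z. f (x + z) \<partial>M)"

text \<open>Compact support is used in this form: if \<open>x\<close> ranges over a ball, then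
  \<open>x + z\<close> stays in one larger ball for almost every \<open>z\<close>, and there a
  continuous \<open>f\<close> is bounded.\<close>

locale bounded_prob_space = prob_space M for M :: "'a::euclidean_space measure" +
  fixes R :: real
  assumes sets_M[measurable_cong]: "sets M = sets borel"
    and AE_norm_le: "AE z in M. norm z \<le> R"
begin

context
  fixes f :: "'a \<Rightarrow> real"
  assumes cont: "continuous_on UNIV f" and nonneg: "\<And>x. 0 \<le> f x"
begin

lemma integrable_translate: "integrable M (\<lambda>z. f (x + z))"
proof -
  note [measurable] = borel_measurable_continuous_onI[OF cont]
  obtain B where B: "\<And>y. norm y \<le> norm x + R \<Longrightarrow> f y \<le> B"
    using continuous_bounded_on_cball[OF cont] by blast
  show ?thesis
    by (rule integrable_const_bound[where B=B])
      (use AE_norm_le in \<open>eventually_elim, auto simp: nonneg intro!: B norm_triangle_le\<close>, measurable)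
qed

lemma translate_mean_nonneg: "0 \<le> translate_mean M f x"
  unfolding translate_mean_def by (intro integral_nonneg_AE AE_I2 nonneg)

lemma nn_integral_translate: "(\<integral>\<^sup>+z. ennreal (f (x + z)) \<partial>M) = ennreal (translate_mean M f x)"
  unfolding translate_mean_def by (intro nn_integral_eq_integral integrable_translate AE_I2 nonneg)

text \<open>Dominated convergence along a convergent sequence: its terms lie in a ball of radius
  \<open>C\<close>, so the translates lie in the ball of radius \<open>C + R\<close>, where a
  constant dominates \<open>f\<close>.\<close>

lemma continuous_translate_mean: "continuous_on UNIV (translate_mean M f)"
proof -
  note [measurable] = borel_measurable_continuous_onI[OF cont]
  have "(translate_mean M f \<circ> X) \<longlonglongrightarrow> translate_mean M f x" if X: "X \<longlonglongrightarrow> x" for X x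
  proof -
    obtain C where C: "\<And>n. norm (X n) \<le> C"
      using convergent_imp_bounded[OF X] by (auto simp: bounded_iff)
    obtain B where B: "\<And>y. norm y \<le> C + R \<Longrightarrow> f y \<le> B"
      using continuous_bounded_on_cball[OF cont] by blast
    show ?thesis
      unfolding translate_mean_def[abs_def] o_def
    proof (rule integral_dominated_convergence[where w="\<lambda>_. B"])
      show "AE z in M. (\<lambda>n. f (X n + z)) \<longlonglongrightarrow> f (x + z)"
        by (intro AE_I2 continuous_on_tendsto_compose[OF cont] tendsto_intros X) auto
      show "AE z in M. norm (f (X n + z)) \<le> B" for n
        using AE_norm_le
        by eventually_elim (auto simp: nonneg intro!: B norm_triangle_le add_mono C)
    qed auto
  qed
  then show ?thesis
    by (auto simp: continuous_on_eq_continuous_at continuous_at_sequentially)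
qed

lemma measurable_translate_mean: "translate_mean M f \<in> borel_measurable borel"
  using continuous_translate_mean by (rule borel_measurable_continuous_onI)

text \<open>The map \<open>T\<close> stands for \<open>A \<mapsto> A *v y\<close>. The argument is
  superadditivity of the geometric mean over \<open>H\<close>, carried out with a truncated mean so
  that every logarithm is finite; the truncation is removed by
  \<open>ereal_integral_ext_log_geI\<close>.\<close>

lemma ext_log_translate_mean_le:
  fixes H :: "'h measure" and T :: "'h \<Rightarrow> 'a"
  assumes "prob_space H" and T[measurable]: "T \<in> borel_measurable H"
    and T_le: "\<And>A. A \<in> space H \<Longrightarrow> norm (T A) \<le> C"
    and le: "\<And>x. ext_log (f x) \<le> ereal_integral H (\<lambda>A. ext_log (f (x + T A)))"
  shows "ext_log (translate_mean M f x) \<le> ereal_integral H (\<lambda>A. ext_log (translate_mean M f (x + T A)))"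
proof (cases "translate_mean M f x = 0")
  case False
  note [measurable] = borel_measurable_continuous_onI[OF cont] measurable_translate_mean
  interpret H: prob_space H by fact
  interpret pair_sigma_finite H M ..
  define g where "g = translate_mean M f"
  have g0: "0 \<le> g y" for y unfolding g_def by (rule translate_mean_nonneg)
  have [measurable]: "g \<in> borel_measurable borel" unfolding g_def by measurable
  obtain B where B: "\<And>y. norm y \<le> norm x + C \<Longrightarrow> g y \<le> B"
    using continuous_bounded_on_cball[OF continuous_translate_mean] unfolding g_def by blast
  have gB: "g (x + T A) \<le> B" if "A \<in> space H" for A
    by (intro B norm_triangle_le add_left_mono T_le that)
  have "ereal (ln (g x)) \<le> ereal_integral H (\<lambda>A. ext_log (g (x + T A)))"
  proof (rule H.ereal_integral_ext_log_geI[where B=B])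
    fix \<epsilon> :: real assume \<epsilon>: "0 < \<epsilon>" "\<epsilon> \<le> 1"
    \<comment> \<open>The floor \<open>\<epsilon>\<close> keeps \<open>m\<close> away from 0:
      \<open>ln (m A)\<close> is bounded and \<open>m A\<close> can serve as a denominator, while
      \<open>m A\<close> still dominates \<open>g (x + T A)\<close>.\<close>
    define m where "m = (\<lambda>A. max (g (x + T A)) \<epsilon>)"
    have [measurable]: "m \<in> borel_measurable H" unfolding m_def by measurable
    have m: "0 < m A" "\<epsilon> \<le> m A" "g (x + T A) \<le> m A" for A using \<epsilon> by (auto simp: m_def)
    have m_le: "m A \<le> max B \<epsilon>" if "A \<in> space H" for A using gB[OF that] by (auto simp: m_def)
    have int_m: "integrable H (\<lambda>A. ln (m A))"
    proof (rule H.integrable_const_bound[where B="\<bar>ln \<epsilon>\<bar> + \<bar>ln (max B \<epsilon>)\<bar>"])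
      show "AE A in H. norm (ln (m A)) \<le> \<bar>ln \<epsilon>\<bar> + \<bar>ln (max B \<epsilon>)\<bar>"
      proof (rule AE_I2)
        fix A assume A: "A \<in> space H"
        have "ln \<epsilon> \<le> ln (m A)" "ln (m A) \<le> ln (max B \<epsilon>)"
          using m[of A] m_le[OF A] \<epsilon> by (auto intro: ln_mono)
        then show "norm (ln (m A)) \<le> \<bar>ln \<epsilon>\<bar> + \<bar>ln (max B \<epsilon>)\<bar>" by auto
      qed
    qed measurable
    define c where "c = H.expectation (\<lambda>A. ln (m A))"
    \<comment> \<open>Jensen for \<open>ln (F / m)\<close>; integrating over \<open>z\<close> turns \<open>F / m\<close> into \<open>g / m \<le> 1\<close>.\<close>
    have f_le: "ennreal (f (x + z)) \<le> ennreal (exp c) * (\<integral>\<^sup>+A. ennreal (f (x + T A + z) / m A) \<partial>H)" for z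
    proof (cases "f (x + z) = 0")
      case False
      define F where "F = (\<lambda>A. f ((x + z) + T A))"
      have [measurable]: "F \<in> borel_measurable H" unfolding F_def by measurable
      have F0: "0 \<le> F A" for A unfolding F_def by (rule nonneg)
      obtain D where D: "\<And>y. norm y \<le> norm (x + z) + C \<Longrightarrow> f y \<le> D"
        using continuous_bounded_on_cball[OF cont] by blast
      have FD: "F A \<le> D" if "A \<in> space H" for A
        unfolding F_def by (intro D norm_triangle_le add_left_mono T_le that)
      \<comment> \<open>As \<open>f (x + z)\<close> is nonzero, the left side is a real number. This
        forces \<open>F\<close> to be positive almost everywhere and \<open>ln F\<close> to be
        integrable.\<close>
      have "ereal (ln (f (x + z))) \<le> ereal_integral H (\<lambda>A. ext_log (F A))"
        using le[of "x + z"] False by (simp add: ext_log_def F_def)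
      note * = H.ereal_integral_ext_log_geD[OF _ F0 FD this, simplified]
      have pos: "AE A in H. exp (ln (F A) - ln (m A)) = F A / m A"
        using *(1) by eventually_elim (auto simp: exp_diff m)
      have "F A / m A \<le> D / \<epsilon>" if "A \<in> space H" for A
        using FD[OF that] F0[of A] m[of A] \<epsilon> by (intro frac_le) auto
      then have int: "integrable H (\<lambda>A. F A / m A)"
        by (intro H.integrable_const_bound[where B="D / \<epsilon>"] AE_I2) (auto simp: F0 m less_imp_le)
      have "exp (H.expectation (\<lambda>A. ln (F A) - ln (m A))) \<le> H.expectation (\<lambda>A. exp (ln (F A) - ln (m A)))"
        using *(2) int_m int
        by (intro H.exp_expectation_le Bochner_Integration.integrable_diff)
          (simp_all add: integrable_cong_AE[OF _ _ pos])
      also have "\<dots> = H.expectation (\<lambda>A. F A / m A)"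
        using pos by (intro integral_cong_AE) auto
      finally have "exp (H.expectation (\<lambda>A. ln (F A)) - c) \<le> H.expectation (\<lambda>A. F A / m A)"
        using *(2) int_m by (simp add: c_def)
      then have "exp (ln (f (x + z)) - c) \<le> H.expectation (\<lambda>A. F A / m A)"
        using *(3) by (meson diff_right_mono exp_le_cancel_iff order_trans)
      then have "f (x + z) \<le> exp c * H.expectation (\<lambda>A. F A / m A)"
        using False nonneg[of "x + z"] by (simp add: exp_diff field_simps)
      then have "ennreal (f (x + z)) \<le> ennreal (exp c) * ennreal (H.expectation (\<lambda>A. F A / m A))"
        by (simp add: ennreal_leI flip: ennreal_mult')
      also have "ennreal (H.expectation (\<lambda>A. F A / m A)) = (\<integral>\<^sup>+A. ennreal (F A / m A) \<partial>H)"
        using int by (intro nn_integral_eq_integral[symmetric] AE_I2) (auto simp: F0 m less_imp_le)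
      finally show ?thesis by (simp add: F_def ac_simps)
    qed simp
    have "ennreal (g x) = (\<integral>\<^sup>+z. ennreal (f (x + z)) \<partial>M)"
      by (simp add: nn_integral_translate g_def)
    also have "\<dots> \<le> (\<integral>\<^sup>+z. ennreal (exp c) * (\<integral>\<^sup>+A. ennreal (f (x + T A + z) / m A) \<partial>H) \<partial>M)"
      by (intro nn_integral_mono f_le)
    also have "\<dots> = ennreal (exp c) * (\<integral>\<^sup>+z. \<integral>\<^sup>+A. ennreal (f (x + T A + z) / m A) \<partial>H \<partial>M)"
      by (intro nn_integral_cmult) measurable
    also have "(\<integral>\<^sup>+z. \<integral>\<^sup>+A. ennreal (f (x + T A + z) / m A) \<partial>H \<partial>M)
        = (\<integral>\<^sup>+A. \<integral>\<^sup>+z. ennreal (f (x + T A + z) / m A) \<partial>M \<partial>H)"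
      by (intro Fubini') measurable
    also have "\<dots> = (\<integral>\<^sup>+A. ennreal (g (x + T A) / m A) \<partial>H)"
    proof (intro nn_integral_cong)
      fix A
      have "(\<integral>\<^sup>+z. ennreal (f (x + T A + z) / m A) \<partial>M) = ennreal (\<integral>z. f (x + T A + z) / m A \<partial>M)"
        using m[of A] by (intro nn_integral_eq_integral integrable_divide_zero integrable_translate AE_I2) (auto simp: nonneg)
      then show "(\<integral>\<^sup>+z. ennreal (f (x + T A + z) / m A) \<partial>M) = ennreal (g (x + T A) / m A)"
        by (simp add: g_def translate_mean_def)
    qed
    also have "\<dots> \<le> (\<integral>\<^sup>+A. 1 \<partial>H)"
      using m by (intro nn_integral_mono) (simp add: divide_le_eq_1)
    finally have "ennreal (g x) \<le> ennreal (exp c)"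
      by (simp add: H.emeasure_space_1 mult_left_mono)
    then have "g x \<le> exp c" by simp
    moreover have "0 < g x" using False g0[of x] by (simp add: g_def)
    ultimately have "ln (g x) \<le> c" by (metis exp_le_cancel_iff exp_ln)
    then show "ln (g x) \<le> H.expectation (\<lambda>A. ln (max (g (x + T A)) \<epsilon>))"
      by (simp add: c_def m_def)
  qed (auto simp: g0 gB)
  with False show ?thesis by (simp add: ext_log_def g_def)
qed (simp add: ext_log_def)

text \<open>Jensen's inequality for the negative part \<open>s\<close> of the logarithm:
  \<open>exp (- \<integral> s)\<close> is at most the mean of \<open>min f 1\<close>, hence at most
  the mean of \<open>f\<close>. This carries local integrability of \<open>log f\<close> over to the
  average.\<close>

lemma e2ennreal_uminus_ext_log_translate_mean_le:
  "e2ennreal (- ext_log (translate_mean M f x)) \<le> (\<integral>\<^sup>+z. e2ennreal (- ext_log (f (x + z))) \<partial>M)"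
    (is "_ \<le> ?J")
proof (cases "?J = \<infinity>")
  case False
  note [measurable] = borel_measurable_continuous_onI[OF cont]
  define s where "s = (\<lambda>z. - ln (min (f (x + z)) 1))"
  have [measurable]: "s \<in> borel_measurable M" unfolding s_def by measurable
  \<comment> \<open>Where \<open>f\<close> vanishes, the convention \<open>ln 0 = 0\<close> gives
    \<open>s\<close> the value 0; such points turn out to form a null set.\<close>
  have s0: "0 \<le> s z" for z using nonneg[of "x + z"] by (cases "f (x + z) = 0") (auto simp: s_def min_def)
  have "AE z in M. e2ennreal (- ext_log (f (x + z))) \<noteq> \<infinity>"
    using False by (intro nn_integral_PInf_AE) auto
  then have pos: "AE z in M. 0 < f (x + z)"
    by eventually_elim (use nonneg in \<open>force simp: ext_log_def less_le split: if_splits\<close>)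
  have J: "?J = (\<integral>\<^sup>+z. ennreal (s z) \<partial>M)"
    by (intro nn_integral_cong_AE; use pos in eventually_elim)
      (auto simp: ext_log_def e2ennreal_ereal s_def min_def ennreal_neg)
  then have int: "integrable M s"
    using False by (intro integrableI_nonneg) (auto simp: s0 less_top)
  have exp_s: "AE z in M. exp (- s z) = min (f (x + z)) 1"
    using pos by eventually_elim (auto simp: s_def)
  have "exp (expectation (\<lambda>z. - s z)) \<le> expectation (\<lambda>z. exp (- s z))"
    using int by (intro exp_expectation_le integrable_const_bound[where B=1 and f="\<lambda>z. exp (- s z)"]) (auto simp: s0)
  also have "\<dots> \<le> translate_mean M f x"
    unfolding translate_mean_def
    by (intro integral_mono_AE integrable_const_bound[where B=1] integrable_translate)
      (use exp_s in \<open>auto simp: s0\<close>)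
  finally have "exp (- expectation s) \<le> translate_mean M f x" by simp
  then have "e2ennreal (- ext_log (translate_mean M f x)) \<le> ennreal (expectation s)"
    by (intro e2ennreal_uminus_ext_log_le translate_mean_nonneg integral_nonneg_AE AE_I2 s0)
  then show ?thesis
    using int by (simp add: J nn_integral_eq_integral s0)
qed simp

end

end

section \<open>Local integrability of the logarithm of the average\<close>

lemma nn_integral_lborel_translate:
  fixes h :: "'a::euclidean_space \<Rightarrow> ennreal"
  assumes [measurable]: "h \<in> borel_measurable borel"
  shows "(\<integral>\<^sup>+x. h (x + z) \<partial>lborel) = (\<integral>\<^sup>+x. h x \<partial>lborel)"
proof -
  have "(\<integral>\<^sup>+x. h x \<partial>lborel) = (\<integral>\<^sup>+x. h x \<partial>distr lborel borel ((+) z))"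
    by (simp add: lborel_distr_plus)
  also have "\<dots> = (\<integral>\<^sup>+x. h (x + z) \<partial>lborel)"
    by (subst nn_integral_distr) (auto simp: add.commute)
  finally show ?thesis ..
qed

text \<open>For Borel \<open>u\<close> the completion does not change the integrals, so Tonelli and
  translation invariance can be applied to \<open>lborel\<close> over balls.\<close>

lemma locally_integrable_iff_cball:
  fixes u :: "real ^ 'n \<Rightarrow> ereal"
  assumes [measurable]: "u \<in> borel_measurable borel"
  shows "locally_integrable u \<longleftrightarrow>
    (\<forall>S. (\<integral>\<^sup>+x. e2ennreal \<bar>u x\<bar> * indicator (cball 0 S) x \<partial>lborel) < \<infinity>)"
    (is "_ \<longleftrightarrow> (\<forall>S. ?I S < \<infinity>)")
proof
  assume "locally_integrable u"
  then show "\<forall>S. ?I S < \<infinity>"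
    by (auto simp: locally_integrable_def nn_integral_completion)
next
  assume *: "\<forall>S. ?I S < \<infinity>"
  have "(\<integral>\<^sup>+x\<in>K. e2ennreal \<bar>u x\<bar> \<partial>lebesgue) < \<infinity>" if "compact K" for K
  proof -
    obtain S where S: "\<forall>x\<in>K. norm x \<le> S"
      using compact_imp_bounded[OF \<open>compact K\<close>] by (auto simp: bounded_iff)
    have "(\<integral>\<^sup>+x\<in>K. e2ennreal \<bar>u x\<bar> \<partial>lebesgue) \<le> ?I S"
      unfolding nn_integral_completion
      by (intro nn_integral_mono mult_left_mono) (use S in \<open>auto simp: indicator_def\<close>)
    with * show ?thesis by (meson le_less_trans)
  qed
  then show "locally_integrable u"
    by (auto simp: locally_integrable_def intro!: measurable_completion)
qed

text \<open>The positive part is bounded on a ball because the average is continuous. The negative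
  part is at most the average of the negative parts, to which Tonelli applies.\<close>

lemma (in bounded_prob_space) locally_integrable_translate_mean:
  fixes f :: "'a \<Rightarrow> real"
  assumes cont: "continuous_on UNIV f" and nonneg: "\<And>x. 0 \<le> f x"
    and fin: "\<And>S. (\<integral>\<^sup>+x. e2ennreal \<bar>ext_log (f x)\<bar> * indicator (cball 0 S) x \<partial>lborel) < \<infinity>"
  shows "(\<integral>\<^sup>+x. e2ennreal \<bar>ext_log (translate_mean M f x)\<bar> * indicator (cball 0 S) x \<partial>lborel) < \<infinity>"
proof -
  note [measurable] = borel_measurable_continuous_onI[OF cont] measurable_translate_mean[OF cont nonneg]
  have [measurable]: "cball (0 :: 'a) T \<in> sets borel" for T :: real by simp
  interpret pair_sigma_finite lborel M ..
  let ?g = "translate_mean M f" and ?I = "indicator (cball 0 S) :: 'a \<Rightarrow> ennreal"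
  let ?u = "\<lambda>x. e2ennreal (- ext_log (f x))"
  obtain B where "\<And>x. norm x \<le> S \<Longrightarrow> ?g x \<le> B"
    using continuous_bounded_on_cball[OF continuous_translate_mean[OF cont nonneg]] by blast
  then have "(\<integral>\<^sup>+x. e2ennreal (ext_log (?g x)) * ?I x \<partial>lborel) \<le> (\<integral>\<^sup>+x. ennreal (ln (max B 1)) * ?I x \<partial>lborel)"
    by (intro nn_integral_mono)
      (auto simp: e2ennreal_ext_log translate_mean_nonneg[OF cont nonneg] indicator_def intro!: ennreal_leI max.coboundedI1)
  also have "\<dots> < \<infinity>"
    using emeasure_lborel_cball_finite[of "0 :: 'a" S]
    by (subst nn_integral_cmult_indicator) (auto simp: ennreal_mult_less_top)
  finally have pos: "(\<integral>\<^sup>+x. e2ennreal (ext_log (?g x)) * ?I x \<partial>lborel) < \<infinity>" .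
  have "(\<integral>\<^sup>+x. e2ennreal (- ext_log (?g x)) * ?I x \<partial>lborel) \<le> (\<integral>\<^sup>+x. (\<integral>\<^sup>+z. ?u (x + z) \<partial>M) * ?I x \<partial>lborel)"
    by (intro nn_integral_mono mult_right_mono e2ennreal_uminus_ext_log_translate_mean_le cont nonneg) auto
  also have "\<dots> = (\<integral>\<^sup>+x. \<integral>\<^sup>+z. ?u (x + z) * ?I x \<partial>M \<partial>lborel)"
    by (intro nn_integral_cong nn_integral_multc[symmetric]) measurable
  also have "\<dots> = (\<integral>\<^sup>+z. \<integral>\<^sup>+x. ?u (x + z) * ?I x \<partial>lborel \<partial>M)"
    by (intro Fubini'[symmetric]) measurable
  \<comment> \<open>A shift by \<open>z\<close> with \<open>norm z \<le> R\<close> moves the ball of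
    radius \<open>S\<close> into that of radius \<open>S + R\<close>; translation invariance then
    makes the bound independent of \<open>z\<close>.\<close>
  also have "\<dots> \<le> (\<integral>\<^sup>+z. (\<integral>\<^sup>+x. e2ennreal \<bar>ext_log (f x)\<bar> * indicator (cball 0 (S + R)) x \<partial>lborel) \<partial>M)"
  proof (intro nn_integral_mono_AE, use AE_norm_le in eventually_elim)
    fix z :: 'a assume "norm z \<le> R"
    then have "(\<integral>\<^sup>+x. ?u (x + z) * ?I x \<partial>lborel)
        \<le> (\<integral>\<^sup>+x. e2ennreal \<bar>ext_log (f (x + z))\<bar> * indicator (cball 0 (S + R)) (x + z) \<partial>lborel)"
      by (intro nn_integral_mono mult_mono)
        (auto simp: e2ennreal_abs indicator_def intro: norm_triangle_le)
    also have "\<dots> = (\<integral>\<^sup>+x. e2ennreal \<bar>ext_log (f x)\<bar> * indicator (cball 0 (S + R)) x \<partial>lborel)"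
      by (intro nn_integral_lborel_translate) measurable
    finally show "(\<integral>\<^sup>+x. ?u (x + z) * ?I x \<partial>lborel) \<le> \<dots>" .
  qed
  also have "\<dots> < \<infinity>"
    using fin[of "S + R"] by (simp add: emeasure_space_1)
  finally show ?thesis
    using pos by (simp add: e2ennreal_abs distrib_right nn_integral_add)
qed

section \<open>Log-subharmonicity of the average and of translates\<close>

lemma norm_orthogonal_matrix_mult:
  fixes A :: "real ^ 'n ^ 'n"
  shows "orthogonal_matrix A \<Longrightarrow> norm (A *v y) = norm y"
  using orthogonal_transformation_matrix[of "(*v) A"]
  by (simp add: orthogonal_transformation)

text \<open>The Haar measure \<open>H\<close> that witnesses subharmonicity of \<open>log f\<close>
  serves again for the average. Upper semicontinuity comes from continuity, since
  \<open>log g < c\<close> means \<open>g < exp c\<close> for real \<open>c\<close>.\<close>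

lemma log_subharmonic_translate_mean:
  fixes f :: "real ^ 'n \<Rightarrow> real" and M :: "(real ^ 'n) measure"
  assumes "bounded_prob_space M R" and cont: "continuous_on UNIV f" and f: "log_subharmonic f"
  shows "log_subharmonic (translate_mean M f)"
proof -
  interpret bounded_prob_space M R by fact
  have nonneg: "0 \<le> f x" for x using f by (auto simp: log_subharmonic_def)
  note g_nonneg = translate_mean_nonneg[OF cont nonneg]
  have [measurable]: "f \<in> borel_measurable borel" "translate_mean M f \<in> borel_measurable borel"
    by (intro borel_measurable_continuous_onI measurable_translate_mean cont nonneg)+
  obtain H where H: "normalized_haar_orthogonal H"
    and le: "\<And>x y. ext_log (f x) \<le> ereal_integral H (\<lambda>A. ext_log (f (x + A *v y)))"
    using f by (auto simp: log_subharmonic_def subharmonic_def)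
  have "ext_log (translate_mean M f x) \<le> ereal_integral H (\<lambda>A. ext_log (translate_mean M f (x + A *v y)))" for x y
  \<comment> \<open>Orthogonal matrices preserve the norm, so the bound required of \<open>T\<close>
    holds with \<open>norm y\<close>.\<close>
  proof (rule ext_log_translate_mean_le[OF cont nonneg, where C="norm y"])
    have "(\<lambda>A::real^'n^'n. A *v y) \<in> borel_measurable borel"
      by (intro borel_measurable_continuous_onI linear_continuous_on linear_conv_bounded_linear[THEN iffD1]
          linearI) (simp_all add: matrix_vector_mult_add_rdistrib scaleR_matrix_vector_assoc)
    then have "(\<lambda>A. A *v y) \<in> borel_measurable (restrict_space borel {A. orthogonal_matrix A})"
      by (rule measurable_restrict_space1)
    moreover have "sets H = sets (restrict_space borel {A. orthogonal_matrix A})"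
      using H by (simp add: normalized_haar_orthogonal_def)
    ultimately show "(\<lambda>A. A *v y) \<in> borel_measurable H"
      using measurable_cong_sets by blast
  qed (use H le in \<open>auto simp: normalized_haar_orthogonal_def norm_orthogonal_matrix_mult\<close>)
  moreover have "upper_semicontinuous (\<lambda>x. ext_log (translate_mean M f x))"
    unfolding upper_semicontinuous_def
  proof
    fix c :: ereal
    show "open {x. ext_log (translate_mean M f x) < c}"
    proof (cases c)
      case (real c')
      then show ?thesis
        by (auto simp: ext_log_less_iff g_nonneg
            intro!: open_Collect_less continuous_translate_mean cont nonneg continuous_on_const)
    qed (auto simp: ext_log_def)
  qed
  moreover have fin: "(\<integral>\<^sup>+x. e2ennreal \<bar>ext_log (translate_mean M f x)\<bar> * indicator (cball 0 S) x \<partial>lborel) < \<infinity>" for S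
    using f by (intro locally_integrable_translate_mean cont nonneg)
      (auto simp: log_subharmonic_def subharmonic_def locally_integrable_iff_cball)
  \<comment> \<open>a function that is identically \<open>-\<infinity>\<close> is not locally integrable\<close>
  moreover have "\<exists>x. ext_log (translate_mean M f x) \<noteq> - \<infinity>"
  proof (rule ccontr)
    assume "\<not> ?thesis"
    then have "(\<integral>\<^sup>+x. top * indicator (cball (0 :: real ^ 'n) 1) x \<partial>lborel) < \<infinity>"
      using fin[of 1] by simp
    moreover have "emeasure lborel (cball (0 :: real ^ 'n) 1) \<noteq> 0"
      using content_cball_pos[of 1 "0 :: real ^ 'n"] by (auto simp: measure_def)
    ultimately show False
      by (subst (asm) nn_integral_cmult_indicator) (auto simp: ennreal_top_mult)
  qed
  moreover have "locally_integrable (\<lambda>x. ext_log (translate_mean M f x))"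
    using fin by (simp add: locally_integrable_iff_cball)
  moreover have "ext_log (translate_mean M f x) < \<infinity>" for x
    by (simp add: ext_log_def)
  ultimately show ?thesis
    using H g_nonneg unfolding log_subharmonic_def subharmonic_def
    by (intro conjI allI exI[of _ H]) auto
qed

lemma log_subharmonic_translate:
  fixes f :: "real ^ 'n \<Rightarrow> real"
  assumes "continuous_on UNIV f" "log_subharmonic f"
  shows "log_subharmonic (\<lambda>x. f (w + x))"
proof -
  \<comment> \<open>averaging over a point mass is translation\<close>
  have "continuous_on UNIV f \<Longrightarrow> translate_mean (return borel w) f = (\<lambda>x. f (w + x))"
    unfolding translate_mean_def
    by (subst integral_return) (auto simp: add.commute intro!: borel_measurable_continuous_onI continuous_intros continuous_on_compose2[of UNIV f])
  moreover have "bounded_prob_space (return borel w) (norm w)"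
    by (auto simp: bounded_prob_space_def bounded_prob_space_axioms_def prob_space_return AE_return)
  ultimately show ?thesis
    using log_subharmonic_translate_mean[OF _ assms] assms(1) by fastforce
qed

section \<open>From compact support to the norm inequality for the convolution\<close>

lemma compactly_supported_imp_bounded:
  fixes M :: "'a::euclidean_space measure"
  assumes "prob_space M" "sets M = sets borel" "compactly_supported M"
  obtains R where "bounded_prob_space M R"
proof -
  have "compact (topological_support M)"
    using assms(3) by (simp add: compactly_supported_def)
  then obtain R where R: "\<forall>x\<in>topological_support M. norm x \<le> R"
    by (meson compact_imp_bounded bounded_iff)
  have "- topological_support M \<in> null_sets M"
    using emeasure_compl_topological_support[OF assms(2)] \<open>compact (topological_support M)\<close>
    by (intro null_setsI) (simp_all add: assms(2) borel_compact borel_comp)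
  then have "AE x in M. norm x \<le> R"
    by (rule AE_I') (use R in blast)
  then have "bounded_prob_space M R"
    by (intro bounded_prob_space.intro bounded_prob_space_axioms.intro assms)
  then show thesis by (rule that)
qed

text \<open>Removes the outer root in \<open>Lp_norm\<close>, turning a norm bound into a bound on
  the integral of the \<open>q\<close>-th power. The maximum accounts for \<open>ennreal\<close>
  sending negative \<open>b\<close> to 0.\<close>

lemma ennreal_powr_le_iff:
  assumes "0 < q"
  shows "ennreal_powr a (1 / q) \<le> ennreal b \<longleftrightarrow> a \<le> ennreal (max b 0 powr q)"
proof (cases a)
  case (real a')
  have "a' powr (1 / q) \<le> max b 0 \<longleftrightarrow> a' \<le> max b 0 powr q"
    using assms real(1) powr_mono2[of q "a' powr (1 / q)" "max b 0"] powr_mono2[of "1 / q" a' "max b 0 powr q"]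
    by (auto simp: powr_powr)
  then show ?thesis
    using real by (simp add: ennreal_powr_def ennreal_le_iff2 max_def split: if_splits)
      (auto simp: max_def split: if_splits)
qed (auto simp: ennreal_powr_def top_unique)

lemma ennreal_powr_mono:
  "0 \<le> s \<Longrightarrow> a \<le> b \<Longrightarrow> ennreal_powr a s \<le> ennreal_powr b s"
  by (cases a; cases b) (auto simp: ennreal_powr_def top_unique intro!: ennreal_leI powr_mono2)

lemma Lp_norm_1: "(\<And>x. 0 \<le> f x) \<Longrightarrow> Lp_norm 1 M f = (\<integral>\<^sup>+x. ennreal (f x) \<partial>M)"
  by (simp add: Lp_norm_def ennreal_powr_def ennreal_enn2real_if)

lemma Lp_norm_dilation_convolution_le:
  fixes \<mu> \<nu> :: "(real ^ 'n) measure"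
  assumes q: "0 < q"
    and "prob_space \<mu>" and sets[measurable_cong]: "sets \<mu> = sets borel"
    and "prob_space \<nu>" "sets \<nu> = sets borel"
    and \<mu>: "\<And>f. continuous_on UNIV f \<Longrightarrow> log_subharmonic f \<Longrightarrow>
           Lp_norm q \<mu> (\<lambda>x. f (r *\<^sub>R x)) \<le> Lp_norm 1 \<mu> f"
    and \<nu>: "\<And>f. continuous_on UNIV f \<Longrightarrow> log_subharmonic f \<Longrightarrow>
           Lp_norm q \<nu> (\<lambda>x. f (r *\<^sub>R x)) \<le> Lp_norm 1 \<nu> f"
    and "compactly_supported \<nu>"
    and cont: "continuous_on UNIV f" and f: "log_subharmonic f"
  shows "Lp_norm q (\<mu> \<star> \<nu>) (\<lambda>x. f (r *\<^sub>R x)) \<le> Lp_norm 1 (\<mu> \<star> \<nu>) f"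
proof -
  obtain R where R: "bounded_prob_space \<nu> R"
    using compactly_supported_imp_bounded assms by blast
  interpret \<nu>: bounded_prob_space \<nu> R by fact
  interpret \<mu>: prob_space \<mu> by fact
  have nonneg: "0 \<le> f x" for x using f by (auto simp: log_subharmonic_def)
  note [measurable] = borel_measurable_continuous_onI[OF cont] \<nu>.measurable_translate_mean[OF cont nonneg]
  note conv = nn_integral_convolution[OF \<mu>.finite_measure_axioms \<nu>.finite_measure_axioms \<nu>.sets_M sets]
  let ?g = "translate_mean \<nu> f"
  have g_nonneg: "0 \<le> ?g x" for x using \<nu>.translate_mean_nonneg[OF cont nonneg] .
  have inner: "(\<integral>\<^sup>+y. ennreal (f (r *\<^sub>R (x + y)) powr q) \<partial>\<nu>) \<le> ennreal (?g (r *\<^sub>R x) powr q)" for x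
  proof -
    \<comment> \<open>The shift is \<open>r *\<^sub>R x\<close> rather than \<open>x\<close>, so
      that dilating the argument of \<open>?h\<close> yields
      \<open>f (r *\<^sub>R (x + y))\<close>.\<close>
    let ?h = "\<lambda>y. f (r *\<^sub>R x + y)"
    have "continuous_on UNIV ?h"
      by (intro continuous_on_compose2[OF cont] continuous_intros) auto
    then have "Lp_norm q \<nu> (\<lambda>y. ?h (r *\<^sub>R y)) \<le> Lp_norm 1 \<nu> ?h"
      by (rule \<nu>[OF _ log_subharmonic_translate[OF cont f]])
    also have "\<dots> = ennreal (?g (r *\<^sub>R x))"
      by (simp add: Lp_norm_1 nonneg \<nu>.nn_integral_translate[OF cont nonneg])
    finally show ?thesis
      by (simp add: Lp_norm_def ennreal_powr_le_iff q nonneg g_nonneg scaleR_add_right)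
  qed
  have "(\<integral>\<^sup>+x. ennreal (\<bar>f (r *\<^sub>R x)\<bar> powr q) \<partial>(\<mu> \<star> \<nu>))
      = (\<integral>\<^sup>+x. \<integral>\<^sup>+y. ennreal (f (r *\<^sub>R (x + y)) powr q) \<partial>\<nu> \<partial>\<mu>)"
    by (subst conv) (auto simp: nonneg)
  also have "\<dots> \<le> (\<integral>\<^sup>+x. ennreal (\<bar>?g (r *\<^sub>R x)\<bar> powr q) \<partial>\<mu>)"
    using inner by (intro nn_integral_mono) (simp add: g_nonneg)
  finally have "Lp_norm q (\<mu> \<star> \<nu>) (\<lambda>x. f (r *\<^sub>R x)) \<le> Lp_norm q \<mu> (\<lambda>x. ?g (r *\<^sub>R x))"
    unfolding Lp_norm_def using q by (intro ennreal_powr_mono) auto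
  also have "\<dots> \<le> Lp_norm 1 \<mu> ?g"
    by (intro \<mu> \<nu>.continuous_translate_mean log_subharmonic_translate_mean[OF R] cont nonneg f)
  also have "\<dots> = Lp_norm 1 (\<mu> \<star> \<nu>) f"
    by (simp add: Lp_norm_1 nonneg g_nonneg conv \<nu>.nn_integral_translate[OF cont nonneg])
  finally show ?thesis .
qed

theorem theorem4p1:
  fixes q r :: real and \<mu>1 \<mu>2 :: "(real ^ 'n) measure"
  assumes "1 < q"
    and "0 < r" "r \<le> 1"
    and "prob_space \<mu>1" "sets \<mu>1 = sets borel"
    and "prob_space \<mu>2" "sets \<mu>2 = sets borel"
    and "\<And>f. continuous_on UNIV f \<Longrightarrow> log_subharmonic f \<Longrightarrow>
           Lp_norm q \<mu>1 (\<lambda>x. f (r *\<^sub>R x)) \<le> Lp_norm 1 \<mu>1 f"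
    and "\<And>f. continuous_on UNIV f \<Longrightarrow> log_subharmonic f \<Longrightarrow>
           Lp_norm q \<mu>2 (\<lambda>x. f (r *\<^sub>R x)) \<le> Lp_norm 1 \<mu>2 f"
    and "compactly_supported \<mu>1 \<or> compactly_supported \<mu>2"
  shows "\<forall>f. continuous_on UNIV f \<longrightarrow> log_subharmonic f \<longrightarrow>
           Lp_norm q (\<mu>1 \<star> \<mu>2) (\<lambda>x. f (r *\<^sub>R x)) \<le> Lp_norm 1 (\<mu>1 \<star> \<mu>2) f"
proof (intro allI impI)
  fix f :: "real ^ 'n \<Rightarrow> real"
  assume f: "continuous_on UNIV f" "log_subharmonic f"
  have q: "0 < q" using \<open>1 < q\<close> by simp
  \<comment> \<open>The inequality was derived with the second factor compactly supported;
    commutativity lets either measure take that place.\<close>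
  have "(\<mu>1 \<star> \<mu>2) = (\<mu>2 \<star> \<mu>1)"
    by (intro convolution_commutative prob_space.axioms(1) assms)
  from assms(10) show "Lp_norm q (\<mu>1 \<star> \<mu>2) (\<lambda>x. f (r *\<^sub>R x)) \<le> Lp_norm 1 (\<mu>1 \<star> \<mu>2) f"
  proof
    assume "compactly_supported \<mu>1"
    then show ?thesis
      unfolding \<open>(\<mu>1 \<star> \<mu>2) = (\<mu>2 \<star> \<mu>1)\<close>
      by (rule Lp_norm_dilation_convolution_le[rotated 7]) (fact q assms f)+
  next
    assume "compactly_supported \<mu>2"
    then show ?thesis
      by (rule Lp_norm_dilation_convolution_le[rotated 7]) (fact q assms f)+
  qed
qed

end
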